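(* Let $(Y_n)_{n\ge 0}$ be a sequence of random variables with $Y_0=0$ and such that, for every $n\ge 1$, the conditional distribution of $Y_n$ given $Y_0,\dots,Y_{n-1}$ is Bernoulli with success probability $\frac{1}{1+\sum_{j=0}^{n-1}Y_j}$, and let $X_n=\sum_{i=0}^{n}Y_i$. Then $$P\big(X_n\ge (1+\epsilon)E(X_n)\big)\le \exp\left(-\tfrac13\epsilon^2E(X_n)\right)\sim e^{-\frac13\epsilon^2\sqrt{2n}},\qquad 0<\epsilon<1,$$ $$P\big(X_n\le (1-\epsilon)E(X_n)\big)\le \exp\left(-\tfrac13\epsilon^2E(X_n)\right)\sim e^{-\frac13\epsilon^2\sqrt{2n}},\qquad 0<\epsilon<1,$$ where $\sim$ refers to $n\to+\infty$.
   Context: For each $n$, $X_n$ has the same distribution as the state at time $n$ of the homogeneous discrete-time Markov chain on $\{0,1,2,\dots\}$ started at $0$ which moves from $i$ to $i+1$ with probability $\frac{1}{1+i}$ and stays at $i$ with probability $\frac{i}{1+i}$.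
   Formalization: The relation ∼ is not read as "ratio tends to 1", which is false since E(X_n) ≤ √(2n+1/4) − 1/2; instead it is proved that the ratio of the two exponentials stays bounded above and away from 0 and that their exponents are asymptotically equivalent. *)

theory Defs
  imports "HOL-Probability.Probability" "HOL-Library.Landau_Symbols"
begin

(* "Y n is Bernoulli with parameter p (y 0, ..., y (n - 1)) conditionally on Y 0, ..., Y (n - 1)".
   All variables are nat-valued, so conditioning on Y 0, ..., Y (n - 1) amounts to elementary
   conditioning on each path y of positive probability. Only y 0, ..., y (n - 1) matter. *)
definition conditionally_bernoulli ::
  "'a measure \<Rightarrow> (nat \<Rightarrow> 'a \<Rightarrow> nat) \<Rightarrow> nat \<Rightarrow> ((nat \<Rightarrow> nat) \<Rightarrow> real) \<Rightarrow> bool" where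
  "conditionally_bernoulli M Y n p \<longleftrightarrow>
     (\<forall>y. \<P>(\<omega> in M. \<forall>j<n. Y j \<omega> = y j) > 0 \<longrightarrow>
       (\<forall>k. \<P>(\<omega> in M. Y n \<omega> = k \<bar> \<forall>j<n. Y j \<omega> = y j)
             = pmf (map_pmf of_bool (bernoulli_pmf (p y))) k))"

(* Equivalence of exponentially small sequences: same order of magnitude, and asymptotically
   equivalent exponents. For f = exp (- c * E(X n)) and g = exp (- c * sqrt (2 * n)), c > 0,
   the ratio f n / g n cannot tend to 1:
   E(X n ^ 2) + E(X n) = 2 * n, hence E(X n) \<le> sqrt (2 * n + 1 / 4) - 1 / 2. *)
definition exp_equiv :: "(nat \<Rightarrow> real) \<Rightarrow> (nat \<Rightarrow> real) \<Rightarrow> bool" where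
  "exp_equiv f g \<longleftrightarrow>
     f \<in> \<Theta>(g) \<and> (\<lambda>n. ln (f n)) \<sim>[sequentially] (\<lambda>n. ln (g n))"

end

theory Submission
  imports Defs
begin

text \<open>
  The partial sums \<open>X n\<close> are Markov: given the past, \<open>Y (Suc n)\<close> succeeds with probability
  \<open>1 / (1 + X n)\<close>. Since this is decreasing in \<open>X n\<close>, a success is negatively correlated with every
  increasing function of \<open>X n\<close>, in particular with \<open>exp (\<theta> * X n)\<close> for \<open>\<theta> \<ge> 0\<close>; for \<open>\<theta> \<le> 0\<close> the
  function \<open>exp (\<theta> * X n)\<close> is decreasing, but the factor \<open>exp \<theta> - 1\<close> of the success probability in
  the generating function of the next step is negative, so the inequality is the same. Thus the moment generating function of \<open>X n\<close> is at most that of a sum of independent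
  Bernoulli variables with the same means, hence at most the Poisson one,
  \<open>exp ((exp \<theta> - 1) * E (X n))\<close> (\<open>chain_mgf_le\<close>). From there Chernoff's argument gives both tails
  (\<open>tail_bound_of_poisson_mgf_bound\<close>).

  The growth of the mean \<open>m\<close> of \<open>X n\<close> comes from two facts about second moments. The quantity
  \<open>X n * (X n + 1)\<close> increases by \<open>2\<close> on average in each step, so \<open>E ((X n)\<^sup>2) + m = 2 * n\<close>. The same
  negative correlation makes the variance at most the mean, so \<open>m\<^sup>2 \<le> E ((X n)\<^sup>2) \<le> m\<^sup>2 + m\<close>.
  Together they confine \<open>m\<close> to the interval from \<open>sqrt (2 * n) - 1\<close> to \<open>sqrt (2 * n)\<close>
  (\<open>chain_mean_bounds\<close>). The bounded distance to \<open>sqrt (2 * n)\<close> makes the exponentials comparable up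
  to a constant factor, and the exponents asymptotically equal.

  These computations only involve the law of \<open>X n\<close>. They are carried out for the finitely
  supported distributions \<open>chain n\<close>, which \<open>distr_partial_sum_eq_chain\<close> identifies with the laws of
  the partial sums.
\<close>

section \<open>Chebyshev's association inequality\<close>

text \<open>
  For two independent copies \<open>x\<close>, \<open>y\<close> the expectation of \<open>(f x - f y) * (g x - g y)\<close> is twice the
  covariance of \<open>f\<close> and \<open>g\<close>. Integrating over \<open>y\<close> first, with \<open>x\<close> fixed, avoids the product space.
\<close>

lemma (in prob_space) expectation_mult_le_of_oppositely_ordered:
  fixes f g :: "'a \<Rightarrow> real"
  assumes f: "integrable M f" and g: "integrable M g" and fg: "integrable M (\<lambda>x. f x * g x)"
    and opposite: "\<And>x y. (f x - f y) * (g x - g y) \<le> 0"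
  shows "expectation (\<lambda>x. f x * g x) \<le> expectation f * expectation g"
proof -
  have average_y: "0 \<le> f x * expectation g + expectation f * g x - f x * g x
      - expectation (\<lambda>y. f y * g y)" for x
  proof -
    have "0 \<le> expectation (\<lambda>y. - ((f x - f y) * (g x - g y)))"
      by (intro Bochner_Integration.integral_nonneg) (simp add: opposite)
    also have "(\<lambda>y. - ((f x - f y) * (g x - g y))) = (\<lambda>y. f x * g y + f y * g x - f x * g x - f y * g y)"
      by (auto simp: algebra_simps)
    also have "expectation \<dots> = f x * expectation g + expectation f * g x - f x * g x
        - expectation (\<lambda>y. f y * g y)"
      using f g fg by (simp add: prob_space)
    finally show ?thesis .
  qed
  have "0 \<le> expectation (\<lambda>x. f x * expectation g + expectation f * g x - f x * g x
      - expectation (\<lambda>y. f y * g y))"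
    using average_y by (intro Bochner_Integration.integral_nonneg) simp
  then show ?thesis
    using f g fg by (simp add: prob_space)
qed

lemma mono_antimono_opposite:
  fixes f g :: "'a::linorder \<Rightarrow> real"
  assumes "mono f" "antimono g"
  shows "(f x - f y) * (g x - g y) \<le> 0"
proof (cases "x \<le> y")
  case True
  then show ?thesis
    using monoD[OF assms(1), of x y] antimonoD[OF assms(2), of x y] by (simp add: mult_nonpos_nonneg)
next
  case False
  then show ?thesis
    using monoD[OF assms(1), of y x] antimonoD[OF assms(2), of y x] by (simp add: mult_nonneg_nonpos)
qed

lemma antimono_inverse_Suc: "antimono (\<lambda>i. 1 / (1 + real i))"
  by (intro antimonoI) (simp add: frac_le)

section \<open>Chernoff's argument from a Poisson moment generating function\<close>

text \<open>
  The two sides agree at \<open>0\<close>. The derivative \<open>ln (1 + x) - 2 * x / 3\<close> of the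
  right side minus left side is nonnegative on \<open>[0, 1]\<close>, because on \<open>[1, 2]\<close> the function
  \<open>ln\<close> lies above its chord, whose slope \<open>ln 2\<close> is at least \<open>2 / 3\<close>. For negative \<open>x\<close> the bound \<open>ln (1 + x) \<le> x\<close> already gives the right sign.
\<close>

lemma square_div_3_le_entropy:
  fixes t :: real
  assumes "-1 < t" "t < 1"
  shows "t\<^sup>2 / 3 \<le> (1 + t) * ln (1 + t) - t"
proof -
  define h where "h = (\<lambda>x::real. (1 + x) * ln (1 + x) - x - x\<^sup>2 / 3)"
  have deriv: "(h has_real_derivative (ln (1 + x) - 2 * x / 3)) (at x)" if "-1 < x" for x
  proof -
    have "(h has_real_derivative (ln (1 + x) + (1 + x) * (1 / (1 + x)) - 1 - 2 * x / 3)) (at x)"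
      unfolding h_def by (rule derivative_eq_intros refl | use that in simp)+
    then show ?thesis using that by simp
  qed
  have "h 0 \<le> h t"
  proof (cases "t \<ge> 0")
    case True
    show ?thesis
    proof (rule DERIV_nonneg_imp_nondecreasing[OF True])
      fix x assume x: "0 \<le> x" "x \<le> t"
      have "x * ln 2 \<le> ln (1 + x)"
        using concave_onD[OF ln_concave, of x 1 2] x assms by (simp add: algebra_simps)
      moreover have "x * (2/3) \<le> x * ln 2"
        using x ln2_ge_two_thirds by (intro mult_left_mono) auto
      ultimately show "\<exists>y. (h has_real_derivative y) (at x) \<and> 0 \<le> y"
        using deriv[of x] x by (intro exI[of _ "ln (1 + x) - 2 * x / 3"]) auto
    qed
  next
    case False
    show ?thesis
    proof (rule DERIV_nonpos_imp_nonincreasing[of t 0 h])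
      fix x assume x: "t \<le> x" "x \<le> 0"
      have "ln (1 + x) \<le> x"
        using x assms by (intro ln_add_one_self_le_self2) auto
      then show "\<exists>y. (h has_real_derivative y) (at x) \<and> y \<le> 0"
        using deriv[of x] x assms by (intro exI[of _ "ln (1 + x) - 2 * x / 3"]) auto
    qed (use False in auto)
  qed
  then show ?thesis by (simp add: h_def)
qed

text \<open>
  Both tails at once: \<open>\<theta> = ln (1 + t)\<close> minimises the exponent \<open>(exp \<theta> - 1) * \<mu> - \<theta> * (1 + t) * \<mu>\<close>, and
  the sign of \<open>\<theta>\<close>, kept as a factor in the event, turns the event into an upper tail for \<open>t > 0\<close> and into a
  lower tail for \<open>t < 0\<close>.
\<close>

lemma (in prob_space) tail_bound_of_poisson_mgf_bound:
  fixes X :: "'a \<Rightarrow> real" and \<mu> t :: real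
  assumes int: "\<And>\<theta>. integrable M (\<lambda>x. exp (\<theta> * X x))"
    and mgf: "\<And>\<theta>. expectation (\<lambda>x. exp (\<theta> * X x)) \<le> exp ((exp \<theta> - 1) * \<mu>)"
    and "0 \<le> \<mu>" "-1 < t" "t < 1"
  shows "prob {x \<in> space M. ln (1 + t) * X x \<ge> ln (1 + t) * ((1 + t) * \<mu>)}
    \<le> exp (- (1/3) * t\<^sup>2 * \<mu>)"
proof -
  define \<theta> where "\<theta> = ln (1 + t)"
  have "prob {x \<in> space M. exp (\<theta> * X x) \<ge> exp (\<theta> * ((1 + t) * \<mu>))}
      \<le> expectation (\<lambda>x. exp (\<theta> * X x)) / exp (\<theta> * ((1 + t) * \<mu>))"
    by (rule integral_Markov_inequality_measure[OF int]) auto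
  also have "\<dots> \<le> exp ((exp \<theta> - 1) * \<mu>) / exp (\<theta> * ((1 + t) * \<mu>))"
    by (intro divide_right_mono mgf) auto
  also have "\<dots> = exp (- (((1 + t) * ln (1 + t) - t) * \<mu>))"
    using assms by (simp add: \<theta>_def flip: exp_diff) (simp add: algebra_simps)
  also have "\<dots> \<le> exp (- (1/3) * t\<^sup>2 * \<mu>)"
    using mult_right_mono[OF square_div_3_le_entropy[OF assms(4,5)] assms(3)] by simp
  finally show ?thesis by (simp add: \<theta>_def)
qed

section \<open>The Markov chain\<close>

primrec chain :: "nat \<Rightarrow> nat pmf" where
  "chain 0 = return_pmf 0"
| "chain (Suc n) = bind_pmf (chain n)
     (\<lambda>i. map_pmf (\<lambda>b. i + of_bool b) (bernoulli_pmf (1 / (1 + real i))))"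

abbreviation chain_mean :: "nat \<Rightarrow> real" where
  "chain_mean n \<equiv> measure_pmf.expectation (chain n) real"

lemma finite_set_chain: "finite (set_pmf (chain n))"
  by (induction n) auto

lemma integrable_chain [simp, intro]: "integrable (measure_pmf (chain n)) (f :: nat \<Rightarrow> real)"
  by (rule integrable_measure_pmf_finite[OF finite_set_chain])

lemma expectation_chain_Suc:
  fixes h :: "nat \<Rightarrow> real"
  shows "measure_pmf.expectation (chain (Suc n)) h
    = measure_pmf.expectation (chain n) (\<lambda>i. h i + (h (Suc i) - h i) / (1 + real i))"
proof -
  have "measure_pmf.expectation (chain (Suc n)) h = (\<Sum>i\<in>set_pmf (chain n). pmf (chain n) i *
      measure_pmf.expectation (bernoulli_pmf (1 / (1 + real i))) (\<lambda>b. h (i + of_bool b)))"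
    by (simp add: pmf_expectation_bind[where A = "set_pmf (chain n)"] finite_set_chain)
  also have "\<dots> = (\<Sum>i\<in>set_pmf (chain n). pmf (chain n) i * (h i + (h (Suc i) - h i) / (1 + real i)))"
  proof (intro sum.cong refl)
    fix i
    have "h (Suc i) * (1 / (1 + real i)) + h i * (1 - 1 / (1 + real i)) = h i + (h (Suc i) - h i) / (1 + real i)"
      by (simp add: right_diff_distrib diff_divide_distrib)
    then show "pmf (chain n) i *
        measure_pmf.expectation (bernoulli_pmf (1 / (1 + real i))) (\<lambda>b. h (i + of_bool b))
      = pmf (chain n) i * (h i + (h (Suc i) - h i) / (1 + real i))"
      by (subst integral_bernoulli_pmf) auto
  qed
  also have "\<dots> = measure_pmf.expectation (chain n) (\<lambda>i. h i + (h (Suc i) - h i) / (1 + real i))"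
    by (subst integral_measure_pmf[OF finite_set_chain]) auto
  finally show ?thesis .
qed

lemma chain_mean_Suc:
  "chain_mean (Suc n) = chain_mean n + measure_pmf.expectation (chain n) (\<lambda>i. 1 / (1 + real i))"
  by (simp only: expectation_chain_Suc) simp

lemma chain_mean_nonneg: "0 \<le> chain_mean n"
  by simp

text \<open>
  Each step multiplies the moment generating function by at most \<open>1 + (exp \<theta> - 1) * r\<close>, where \<open>r\<close> is
  the mean success probability and also the increase of the mean: the conditional increment factor
  \<open>(exp \<theta> - 1) / (1 + i)\<close> is ordered oppositely to \<open>exp (\<theta> * i)\<close>, whatever the sign of \<open>\<theta>\<close>.
\<close>

lemma chain_mgf_le:
  "measure_pmf.expectation (chain n) (\<lambda>i. exp (\<theta> * real i)) \<le> exp ((exp \<theta> - 1) * chain_mean n)"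
proof (induction n)
  case 0
  show ?case by simp
next
  case (Suc n)
  let ?E = "measure_pmf.expectation (chain n)"
  let ?f = "\<lambda>i. exp (\<theta> * real i)"
  let ?g = "\<lambda>i. (exp \<theta> - 1) * (1 / (1 + real i))"
  have opposite: "(?f i - ?f j) * (?g i - ?g j) \<le> 0" for i j
  proof (cases "\<theta> \<ge> 0")
    case True
    have "mono ?f"
      using True by (intro monoI) (simp add: mult_left_mono)
    moreover have "antimono ?g"
      using True by (intro antimonoI mult_left_mono antimonoD[OF antimono_inverse_Suc]) auto
    ultimately show ?thesis by (rule mono_antimono_opposite)
  next
    case False
    have "antimono ?f"
      using False by (intro antimonoI) (simp add: mult_left_mono_neg)
    moreover have "mono ?g"
      using False by (intro monoI mult_left_mono_neg antimonoD[OF antimono_inverse_Suc]) auto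
    ultimately show ?thesis
      using mono_antimono_opposite[of ?g ?f i j] by (simp only: mult.commute)
  qed
  have "measure_pmf.expectation (chain (Suc n)) ?f = ?E (\<lambda>i. ?f i + ?f i * ?g i)"
    unfolding expectation_chain_Suc by (intro Bochner_Integration.integral_cong)
      (auto simp: field_simps exp_add)
  also have "\<dots> = ?E ?f + ?E (\<lambda>i. ?f i * ?g i)"
    by simp
  also have "\<dots> \<le> ?E ?f + ?E ?f * ?E ?g"
    using measure_pmf.expectation_mult_le_of_oppositely_ordered[of "chain n" ?f ?g] opposite by simp
  also have "\<dots> = ?E ?f * (1 + ?E ?g)"
    by (simp add: algebra_simps)
  also have "\<dots> \<le> ?E ?f * exp (?E ?g)"
    by (intro mult_left_mono exp_ge_add_one_self Bochner_Integration.integral_nonneg) auto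
  also have "\<dots> \<le> exp ((exp \<theta> - 1) * chain_mean n) * exp (?E ?g)"
    by (intro mult_right_mono Suc.IH) auto
  also have "\<dots> = exp ((exp \<theta> - 1) * chain_mean (Suc n))"
    unfolding chain_mean_Suc integral_mult_right_zero
    by (simp add: distrib_left flip: exp_add)
  finally show ?case .
qed

text \<open>
  From state \<open>i\<close> the function \<open>i * (i + 1)\<close> increases by \<open>2 * (i + 1)\<close> with probability \<open>1 / (1 + i)\<close>, so
  its mean increases by exactly \<open>2\<close>.
\<close>

lemma chain_second_moment:
  "measure_pmf.expectation (chain n) (\<lambda>i. (real i)\<^sup>2) + chain_mean n = 2 * real n"
proof -
  have "measure_pmf.expectation (chain n) (\<lambda>i. (real i)\<^sup>2 + real i) = 2 * real n"
  proof (induction n)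
    case (Suc n)
    have "(real i)\<^sup>2 + real i + ((real (Suc i))\<^sup>2 + real (Suc i) - ((real i)\<^sup>2 + real i)) / (1 + real i)
        = ((real i)\<^sup>2 + real i) + 2" for i
      by (simp add: field_simps power2_eq_square)
    then show ?case
      unfolding expectation_chain_Suc using Suc by simp
  qed simp
  then show ?thesis by simp
qed

text \<open>
  A sum of independent Bernoulli variables has variance at most its mean; the negative correlation
  between the state and the next success only helps.
\<close>

lemma chain_variance_le_mean:
  "measure_pmf.expectation (chain n) (\<lambda>i. (real i)\<^sup>2) \<le> (chain_mean n)\<^sup>2 + chain_mean n"
proof (induction n)
  case (Suc n)
  let ?E = "measure_pmf.expectation (chain n)"
  let ?r = "\<lambda>i. 1 / (1 + real i)"
  have opposite: "(real i - real j) * (?r i - ?r j) \<le> 0" for i j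
    by (rule mono_antimono_opposite[OF _ antimono_inverse_Suc]) (simp add: monoI)
  have "measure_pmf.expectation (chain (Suc n)) (\<lambda>i. (real i)\<^sup>2)
      = ?E (\<lambda>i. (real i)\<^sup>2 + 2 * (real i * ?r i) + ?r i)"
    unfolding expectation_chain_Suc by (intro Bochner_Integration.integral_cong)
      (auto simp: field_simps power2_eq_square)
  also have "\<dots> = ?E (\<lambda>i. (real i)\<^sup>2) + 2 * ?E (\<lambda>i. real i * ?r i) + ?E ?r"
    by (simp del: times_divide_eq_right)
  also have "\<dots> \<le> (chain_mean n)\<^sup>2 + chain_mean n + 2 * (chain_mean n * ?E ?r) + ?E ?r + (?E ?r)\<^sup>2"
    using measure_pmf.expectation_mult_le_of_oppositely_ordered[of "chain n" real ?r] opposite Suc.IH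
    by (smt (verit, best) integrable_chain zero_le_power2)
  also have "\<dots> = (chain_mean (Suc n))\<^sup>2 + chain_mean (Suc n)"
    unfolding chain_mean_Suc by (simp add: power2_eq_square algebra_simps)
  finally show ?case .
qed simp

lemma chain_mean_bounds:
  shows chain_mean_le: "chain_mean n \<le> sqrt (2 * real n)"
    and chain_mean_ge: "sqrt (2 * real n) - 1 \<le> chain_mean n"
proof -
  let ?m = "chain_mean n" and ?s = "measure_pmf.expectation (chain n) (\<lambda>i. (real i)\<^sup>2)"
  have "?m\<^sup>2 \<le> ?s"
    using measure_pmf.variance_positive[of "chain n" real]
      measure_pmf.variance_eq[of "chain n" real] by simp
  then have "?m\<^sup>2 \<le> 2 * real n"
    using chain_second_moment[of n] chain_mean_nonneg[of n] by linarith
  then show "?m \<le> sqrt (2 * real n)"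
    by (rule real_le_rsqrt)
  \<comment> \<open>The two moment lemmas give \<open>2 * n \<le> m\<^sup>2 + 2 * m\<close>; adding 1 completes the square.\<close>
  have "2 * real n \<le> (?m + 1)\<^sup>2"
    using chain_second_moment[of n] chain_variance_le_mean[of n] by (simp add: power2_eq_square algebra_simps)
  then have "sqrt (2 * real n) \<le> ?m + 1"
    using chain_mean_nonneg[of n] by (intro real_le_lsqrt) auto
  then show "sqrt (2 * real n) - 1 \<le> ?m" by simp
qed

section \<open>Equivalence of the exponential bounds\<close>

lemma exp_equiv_of_bounded_difference:
  fixes a b :: "nat \<Rightarrow> real"
  assumes "c > 0" and le: "\<And>n. a n \<le> b n" and ge: "\<And>n. b n - K \<le> a n"
    and b: "filterlim b at_top sequentially"
  shows "exp_equiv (\<lambda>n. exp (- c * a n)) (\<lambda>n. exp (- c * b n))"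
  unfolding exp_equiv_def
proof
  show "(\<lambda>n. exp (- c * a n)) \<in> \<Theta>(\<lambda>n. exp (- c * b n))"
  proof (rule bigthetaI'[of 1 "exp (c * K)"])
    have "exp (- c * b n) \<le> exp (- c * a n)" for n
      using le[of n] \<open>c > 0\<close> by simp
    moreover have "exp (- c * a n) \<le> exp (c * K) * exp (- c * b n)" for n
      using mult_left_mono[OF ge[of n], of c] \<open>c > 0\<close> by (simp add: algebra_simps flip: exp_add)
    ultimately show "\<forall>\<^sub>F n in sequentially. 1 * norm (exp (- c * b n)) \<le> norm (exp (- c * a n)) \<and>
        norm (exp (- c * a n)) \<le> exp (c * K) * norm (exp (- c * b n))"
      by simp
  qed auto
  have pos: "\<forall>\<^sub>F n in sequentially. b n > 0"
    using b by (simp add: filterlim_at_top_dense)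
  have "(\<lambda>n. a n / b n) \<longlonglongrightarrow> 1"
  proof (rule tendsto_sandwich)
    show "\<forall>\<^sub>F n in sequentially. 1 - K / b n \<le> a n / b n"
      using pos
    proof eventually_elim
      case (elim n)
      have "1 - K / b n = (b n - K) / b n"
        using elim by (simp add: field_simps)
      also have "\<dots> \<le> a n / b n"
        using elim ge by (intro divide_right_mono) auto
      finally show ?case .
    qed
    show "\<forall>\<^sub>F n in sequentially. a n / b n \<le> 1"
      using pos by eventually_elim (use le in \<open>auto simp: field_simps\<close>)
    have "(\<lambda>n. 1 - K / b n) \<longlonglongrightarrow> 1 - 0"
      by (intro tendsto_intros tendsto_divide_0[OF tendsto_const] filterlim_at_top_imp_at_infinity b)
    then show "(\<lambda>n. 1 - K / b n) \<longlonglongrightarrow> 1" by simp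
  qed simp
  then have "(\<lambda>n. (- c * a n) / (- c * b n)) \<longlonglongrightarrow> 1"
    using \<open>c > 0\<close> by simp
  then show "(\<lambda>n. ln (exp (- c * a n))) \<sim>[sequentially] (\<lambda>n. ln (exp (- c * b n)))"
    unfolding ln_exp by (rule asymp_equivI')
qed

section \<open>The law of the partial sums\<close>

text \<open>
  The hypothesis speaks of whole paths, but its success probability depends on the path only through
  the sum. An event fixing the sum \<open>s\<close> splits into finitely many path events, because every entry is
  at most \<open>s\<close>; adding up over these paths conditions on the sum alone.
\<close>

lemma prob_sum_and_next:
  fixes Y :: "nat \<Rightarrow> 'a \<Rightarrow> nat" and q :: "nat \<Rightarrow> real"
  assumes "prob_space M"
    and Y [measurable]: "\<And>n. Y n \<in> measurable M (count_space UNIV)"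
    and cond: "conditionally_bernoulli M Y n (\<lambda>y. q (\<Sum>j<n. y j))"
  shows "\<P>(\<omega> in M. (\<Sum>j<n. Y j \<omega>) = s \<and> Y n \<omega> = k)
    = \<P>(\<omega> in M. (\<Sum>j<n. Y j \<omega>) = s) * pmf (map_pmf of_bool (bernoulli_pmf (q s))) k"
proof -
  interpret prob_space M by fact
  \<comment> \<open>Extensional paths, so that distinct members of \<open>F\<close> describe disjoint events.\<close>
  define F where "F = {y \<in> {..<n} \<rightarrow>\<^sub>E {..s}. (\<Sum>j<n. y j) = s}"
  define A where "A y = {\<omega> \<in> space M. \<forall>j<n. Y j \<omega> = y j}" for y
  define B where "B y = {\<omega> \<in> space M. Y n \<omega> = k \<and> (\<forall>j<n. Y j \<omega> = y j)}" for y
  have finF: "finite F"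
    unfolding F_def by (rule finite_subset[OF _ finite_PiE[of "{..<n}" "\<lambda>_. {..s}"]]) auto
  have y_eq: "y = z" if "y \<in> F" "z \<in> F" "\<forall>j<n. y j = z j" for y z
    using that unfolding F_def by (auto intro!: PiE_ext[of y "{..<n}" "\<lambda>_. {..s}" z])
  have disjA: "disjoint_family_on A F"
    unfolding disjoint_family_on_def A_def using y_eq by force
  have disjB: "disjoint_family_on B F"
    unfolding disjoint_family_on_def B_def using y_eq by force
  have in_F: "restrict (\<lambda>j. Y j \<omega>) {..<n} \<in> F" if "(\<Sum>j<n. Y j \<omega>) = s" for \<omega>
    using that member_le_sum[of _ "{..<n}" "\<lambda>j. Y j \<omega>"] unfolding F_def by auto
  have sum_F: "(\<Sum>j<n. Y j \<omega>) = s" if "y \<in> F" "\<forall>j<n. Y j \<omega> = y j" for y \<omega>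
    using that unfolding F_def by auto
  have sum_iff: "(\<Sum>j<n. Y j \<omega>) = s \<longleftrightarrow> (\<exists>y\<in>F. \<forall>j<n. Y j \<omega> = y j)" for \<omega>
  proof
    assume "(\<Sum>j<n. Y j \<omega>) = s"
    then show "\<exists>y\<in>F. \<forall>j<n. Y j \<omega> = y j"
      by (intro bexI[OF _ in_F]) simp_all
  qed (use sum_F in blast)
  have UA: "{\<omega> \<in> space M. (\<Sum>j<n. Y j \<omega>) = s} = (\<Union>y\<in>F. A y)"
    unfolding A_def sum_iff by blast
  have UB: "{\<omega> \<in> space M. (\<Sum>j<n. Y j \<omega>) = s \<and> Y n \<omega> = k} = (\<Union>y\<in>F. B y)"
    unfolding B_def sum_iff by blast
  have B_eq: "prob (B y) = prob (A y) * pmf (map_pmf of_bool (bernoulli_pmf (q s))) k" if "y \<in> F" for y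
  proof (cases "prob (A y) > 0")
    case True
    then have "prob (B y) / prob (A y) = pmf (map_pmf of_bool (bernoulli_pmf (q s))) k"
      using cond that unfolding conditionally_bernoulli_def cond_prob_def A_def B_def F_def by auto
    then show ?thesis using True by (auto simp: field_simps)
  next
    case False
    \<comment> \<open>The conditional law says nothing about a null path, but there both sides vanish.\<close>
    then have "prob (A y) = 0" using measure_nonneg[of M "A y"] by linarith
    moreover have "prob (B y) \<le> prob (A y)"
      unfolding A_def B_def by (intro finite_measure_mono) auto
    ultimately show ?thesis using measure_nonneg[of M "B y"] by simp
  qed
  have "prob (\<Union>y\<in>F. B y) = (\<Sum>y\<in>F. prob (B y))"
    by (rule finite_measure_finite_Union[OF finF _ disjB]) (auto simp: B_def)
  also have "\<dots> = (\<Sum>y\<in>F. prob (A y)) * pmf (map_pmf of_bool (bernoulli_pmf (q s))) k"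
    by (simp add: B_eq sum_distrib_right)
  also have "(\<Sum>y\<in>F. prob (A y)) = prob (\<Union>y\<in>F. A y)"
    by (rule finite_measure_finite_Union[symmetric, OF finF _ disjA]) (auto simp: A_def)
  finally show ?thesis unfolding UA UB .
qed

lemma distr_pair_eq_measure_pmf:
  fixes S Z :: "'a \<Rightarrow> nat"
  assumes "prob_space M"
    and [measurable]: "S \<in> measurable M (count_space UNIV)" "Z \<in> measurable M (count_space UNIV)"
    and law: "distr M (count_space UNIV) S = measure_pmf p"
    and next_law: "\<And>s k. \<P>(\<omega> in M. S \<omega> = s \<and> Z \<omega> = k) = \<P>(\<omega> in M. S \<omega> = s) * pmf (K s) k"
  shows "distr M (count_space UNIV) (\<lambda>\<omega>. (S \<omega>, Z \<omega>))
    = measure_pmf (bind_pmf p (\<lambda>s. map_pmf (Pair s) (K s)))"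
proof (rule measure_eqI_countable[where A = UNIV])
  interpret prob_space M by fact
  fix x :: "nat \<times> nat"
  obtain s k where x: "x = (s, k)" by force
  have "prob {\<omega> \<in> space M. S \<omega> = s} = measure (distr M (count_space UNIV) S) {s}"
    by (subst measure_distr) (auto intro!: arg_cong[where f = prob])
  also have "\<dots> = pmf p s" by (simp add: law pmf.rep_eq)
  finally have S: "prob {\<omega> \<in> space M. S \<omega> = s} = pmf p s" .
  have "pmf (bind_pmf p (\<lambda>s. map_pmf (Pair s) (K s))) (s, k) = pmf p s * pmf (K s) k"
  proof -
    have "pmf (map_pmf (Pair i) (K i)) (s, k) = (if i = s then pmf (K s) k else 0)" for i
      using pmf_map_inj'[of "Pair s" "K s" k] by (auto simp: inj_on_def pmf_map_outside image_iff)
    then show ?thesis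
      by (simp add: pmf_bind) (subst integral_measure_pmf_real[of "{s}"], auto split: if_splits)
  qed
  moreover have "emeasure (distr M (count_space UNIV) (\<lambda>\<omega>. (S \<omega>, Z \<omega>))) {x}
      = prob {\<omega> \<in> space M. S \<omega> = s \<and> Z \<omega> = k}"
    unfolding x by (subst emeasure_distr) (auto simp: emeasure_eq_measure intro!: arg_cong[where f = prob])
  ultimately show "emeasure (distr M (count_space UNIV) (\<lambda>\<omega>. (S \<omega>, Z \<omega>))) {x}
      = emeasure (measure_pmf (bind_pmf p (\<lambda>s. map_pmf (Pair s) (K s)))) {x}"
    unfolding x next_law S by (simp add: emeasure_pmf_single)
qed auto

lemma distr_partial_sum_eq_chain:
  fixes Y :: "nat \<Rightarrow> 'a \<Rightarrow> nat"
  assumes "prob_space M"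
    and Y [measurable]: "\<And>n. Y n \<in> measurable M (count_space UNIV)"
    and Y0: "AE \<omega> in M. Y 0 \<omega> = 0"
    and cond: "\<And>n. n \<ge> 1 \<Longrightarrow>
           conditionally_bernoulli M Y n (\<lambda>y. 1 / (1 + (\<Sum>j<n. real (y j))))"
  shows "distr M (count_space UNIV) (\<lambda>\<omega>. \<Sum>i\<le>n. Y i \<omega>) = measure_pmf (chain n)"
proof (induction n)
  case 0
  interpret prob_space M by fact
  have "distr M (count_space UNIV) (\<lambda>\<omega>. \<Sum>i\<le>0. Y i \<omega>) = distr M (count_space UNIV) (\<lambda>_. 0)"
    using Y0 by (intro distr_cong_AE) auto
  also have "\<dots> = return (count_space UNIV) 0"
    by (simp add: distr_const)
  finally show ?case by (simp add: return_pmf.rep_eq)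
next
  case (Suc n)
  interpret prob_space M by fact
  let ?S = "\<lambda>\<omega>. \<Sum>i\<le>n. Y i \<omega>"
  let ?K = "\<lambda>i. map_pmf of_bool (bernoulli_pmf (1 / (1 + real i))) :: nat pmf"
  have joint: "distr M (count_space UNIV) (\<lambda>\<omega>. (?S \<omega>, Y (Suc n) \<omega>))
      = measure_pmf (bind_pmf (chain n) (\<lambda>s. map_pmf (Pair s) (?K s)))"
  proof (rule distr_pair_eq_measure_pmf[OF assms(1) _ Y Suc.IH])
    show "\<P>(\<omega> in M. ?S \<omega> = s \<and> Y (Suc n) \<omega> = k) = \<P>(\<omega> in M. ?S \<omega> = s) * pmf (?K s) k" for s k
      using prob_sum_and_next[OF assms(1) Y, where n = "Suc n" and q = "\<lambda>i. 1 / (1 + real i)" and s = s and k = k] cond[of "Suc n"]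
      by (simp add: lessThan_Suc_atMost)
  qed simp
  have "distr M (count_space UNIV) (\<lambda>\<omega>. \<Sum>i\<le>Suc n. Y i \<omega>)
      = distr (distr M (count_space UNIV) (\<lambda>\<omega>. (?S \<omega>, Y (Suc n) \<omega>))) (count_space UNIV) (\<lambda>(s, k). s + k)"
    by (subst distr_distr) (auto simp: comp_def)
  also have "\<dots> = measure_pmf (map_pmf (\<lambda>(s, k). s + k) (bind_pmf (chain n) (\<lambda>s. map_pmf (Pair s) (?K s))))"
    unfolding joint map_pmf_rep_eq ..
  also have "map_pmf (\<lambda>(s, k). s + k) (bind_pmf (chain n) (\<lambda>s. map_pmf (Pair s) (?K s))) = chain (Suc n)"
    by (simp add: map_bind_pmf pmf.map_comp comp_def)
  finally show ?case .
qed

theorem corollary2p7: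
  fixes M :: "'a measure"
    and Y X :: "nat \<Rightarrow> 'a \<Rightarrow> nat"
    and \<epsilon> :: real
  assumes "prob_space M"
    and "\<And>n. Y n \<in> measurable M (count_space UNIV)"
    and "AE \<omega> in M. Y 0 \<omega> = 0"
    and "\<And>n. n \<ge> 1 \<Longrightarrow>
           conditionally_bernoulli M Y n (\<lambda>y. 1 / (1 + (\<Sum>j<n. real (y j))))"
    and "\<And>n \<omega>. X n \<omega> = (\<Sum>i\<le>n. Y i \<omega>)"
    and "0 < \<epsilon>" and "\<epsilon> < 1"
  shows "(\<forall>n. \<P>(\<omega> in M. real (X n \<omega>) \<ge> (1 + \<epsilon>) * (LINT \<omega>'|M. real (X n \<omega>')))
              \<le> exp (- (1/3) * \<epsilon>\<^sup>2 * (LINT \<omega>|M. real (X n \<omega>))))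
       \<and> (\<forall>n. \<P>(\<omega> in M. real (X n \<omega>) \<le> (1 - \<epsilon>) * (LINT \<omega>'|M. real (X n \<omega>')))
              \<le> exp (- (1/3) * \<epsilon>\<^sup>2 * (LINT \<omega>|M. real (X n \<omega>))))
       \<and> exp_equiv (\<lambda>n. exp (- (1/3) * \<epsilon>\<^sup>2 * (LINT \<omega>|M. real (X n \<omega>))))
                   (\<lambda>n. exp (- (1/3) * \<epsilon>\<^sup>2 * sqrt (2 * real n)))"
proof -
  note Y [measurable] = assms(2)
  have X [measurable]: "X n \<in> measurable M (count_space UNIV)" for n
    unfolding assms(5) by measurable
  have law: "distr M (count_space UNIV) (X n) = measure_pmf (chain n)" for n
    using distr_partial_sum_eq_chain[OF assms(1-4), of n] unfolding assms(5) .
  have mean: "(LINT \<omega>|M. real (X n \<omega>)) = chain_mean n" for n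
    unfolding law[symmetric] by (subst integral_distr) auto
  have prob: "\<P>(\<omega> in M. P (X n \<omega>)) = measure_pmf.prob (chain n) {i. P i}" for n P
    unfolding law[symmetric] by (subst measure_distr) (auto intro!: arg_cong[where f = "measure M"])
  have tail: "measure_pmf.prob (chain n) {i. ln (1 + t) * real i \<ge> ln (1 + t) * ((1 + t) * chain_mean n)}
      \<le> exp (- (1/3) * t\<^sup>2 * chain_mean n)" if "-1 < t" "t < 1" for n t
    using measure_pmf.tail_bound_of_poisson_mgf_bound[OF integrable_chain chain_mgf_le chain_mean_nonneg that]
    by simp
  \<comment> \<open>Dividing by \<open>ln (1 + t)\<close>, positive for \<open>t = \<epsilon>\<close> and negative for \<open>t = - \<epsilon>\<close>, gives the two tails.\<close>
  have upper: "measure_pmf.prob (chain n) {i. real i \<ge> (1 + \<epsilon>) * chain_mean n}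
      \<le> exp (- (1/3) * \<epsilon>\<^sup>2 * chain_mean n)" for n
    using tail[of \<epsilon> n] assms(6,7) by simp
  have lower: "measure_pmf.prob (chain n) {i. real i \<le> (1 - \<epsilon>) * chain_mean n}
      \<le> exp (- (1/3) * \<epsilon>\<^sup>2 * chain_mean n)" for n
    using tail[of "- \<epsilon>" n] assms(6,7) by simp
  have "filterlim (\<lambda>n. sqrt (2 * real n)) at_top sequentially"
    by (intro filterlim_compose[OF sqrt_at_top] filterlim_tendsto_pos_mult_at_top[OF tendsto_const]
        filterlim_real_sequentially) auto
  then have equiv: "exp_equiv (\<lambda>n. exp (- (1/3 * \<epsilon>\<^sup>2) * chain_mean n))
      (\<lambda>n. exp (- (1/3 * \<epsilon>\<^sup>2) * sqrt (2 * real n)))"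
    using assms(6) chain_mean_le chain_mean_ge
    by (intro exp_equiv_of_bounded_difference[where K = 1]) auto
  show ?thesis
    unfolding mean prob[where P = "\<lambda>i. real i \<ge> (1 + \<epsilon>) * chain_mean n" for n]
      prob[where P = "\<lambda>i. real i \<le> (1 - \<epsilon>) * chain_mean n" for n]
    using upper lower equiv by simp
qed

end
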